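(* Let $f:\mathbb{N}\to\mathbb{R}$ be a function such that for every positive integer $m$ and every disjointness graph $G$ of a finite system of segments in $\mathbb{R}^2$ with $\max(\alpha(G),\omega(G))\le m$ we have $|V(G)|\le f(m)$. Then for every positive integer $m$ and every disjointness graph $G$ of a finite system of segments in $\mathbb{R}^3$ with $\max(\alpha(G),\omega(G))\le m$ we have $|V(G)|\le f(m)+m^4$.
   Context: The disjointness graph of a family of segments is the graph whose vertices are the segments, two adjacent iff they are disjoint. $\alpha$ and $\omega$ denote independence number and clique number. *)

theory Defs
  imports "HOL-Analysis.Analysis" "HOL-Library.Ramsey"
begin

text \<open>A segment is the point set of a closed non-degenerate line segment; a system of segments
  is a set of such point sets, so its members are pairwise distinct.\<close>

definition is_segment :: "'a::real_vector set \<Rightarrow> bool" where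
  "is_segment s \<longleftrightarrow> (\<exists>a b. a \<noteq> b \<and> s = closed_segment a b)"

definition segment_system :: "'a::real_vector set set \<Rightarrow> bool" where
  "segment_system S \<longleftrightarrow> finite S \<and> (\<forall>s\<in>S. is_segment s)"

text \<open>Graphs are given, as in \<^theory>\<open>HOL-Library.Ramsey\<close>, by a vertex set and a set of
  two-element edges. Segments are non-empty, so disjoint segments are distinct and the set
  below contains no loops.\<close>

definition disjointness_edges :: "'a::real_vector set set \<Rightarrow> 'a set set set" where
  "disjointness_edges S = {{s, t} | s t. s \<in> S \<and> t \<in> S \<and> disjnt s t}"

definition independence_number :: "'v set \<Rightarrow> 'v set set \<Rightarrow> nat" where
  "independence_number V E = Max (card ` {R. R \<subseteq> V \<and> indep R E})"

definition clique_number :: "'v set \<Rightarrow> 'v set set \<Rightarrow> nat" where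
  "clique_number V E = Max (card ` {R. R \<subseteq> V \<and> clique R E})"

end

theory Submission
  imports Defs
begin

text \<open>Every segment meets some member \<open>s\<close> of a maximum clique. Two segments that meet \<open>s\<close> at different
  points and span different planes with \<open>s\<close> are disjoint, so a greedy selection yields at most
  \<open>m\<close> planes through \<open>s\<close> and at most \<open>m\<close> points on \<open>s\<close> that account for all segments meeting \<open>s\<close>;
  each point accounts for at most \<open>m - 1\<close> segments besides \<open>s\<close>. The remaining segments lie in at most
  \<open>m\<^sup>2\<close> planes. Treat these planes one after the other: among the segments that lie in the new plane
  but in no later one, discard those meeting the cliques chosen so far, and choose a maximum
  clique of the rest. A segment chosen earlier is not contained in the new plane, hence meets it in at
  most one point and causes at most \<open>m - 1\<close> deletions. The chosen cliques together form a clique, so their sizes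
  add up to at most \<open>m\<close>, and the kept parts of the planes can be placed far apart in a single plane.
  At most \<open>m\<^sup>2(m - 1) + m(m\<^sup>2 - 1)(m - 1) \<le> m\<^sup>4\<close> segments are discarded.\<close>

section \<open>Cliques and independent sets of the disjointness graph as families of
  segments\<close>

abbreviation meeting :: "'a set set \<Rightarrow> bool" where
  "meeting \<equiv> pairwise (\<lambda>s t. \<not> disjnt s t)"

lemma edge_iff:
  assumes "s \<in> S" "t \<in> S"
  shows "{s, t} \<in> disjointness_edges S \<longleftrightarrow> disjnt s t"
proof
  assume "{s, t} \<in> disjointness_edges S"
  then obtain a b where "{s, t} = {a, b}" "disjnt a b"
    unfolding disjointness_edges_def by blast
  then show "disjnt s t"
    by (metis disjnt_sym doubleton_eq_iff)
qed (use assms in \<open>auto simp: disjointness_edges_def\<close>)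

lemma clique_iff:
  "R \<subseteq> S \<Longrightarrow> clique R (disjointness_edges S) \<longleftrightarrow> pairwise disjnt R"
  unfolding clique_def pairwise_def by (metis edge_iff subsetD)

lemma indep_iff:
  "R \<subseteq> S \<Longrightarrow> indep R (disjointness_edges S) \<longleftrightarrow> meeting R"
  unfolding indep_def pairwise_def by (metis edge_iff subsetD)

text \<open>A maximum over a finite set is at most \<open>m\<close> iff every member is; the empty
  family keeps that set non-empty. This and its independent counterpart let the geometric part speak
  of subfamilies only.\<close>

lemma clique_number_le_iff:
  assumes "finite S"
  shows "clique_number S (disjointness_edges S) \<le> m \<longleftrightarrow>
    (\<forall>X\<subseteq>S. pairwise disjnt X \<longrightarrow> card X \<le> m)"
proof -
  have "{R. R \<subseteq> S \<and> clique R (disjointness_edges S)} = {R. R \<subseteq> S \<and> pairwise disjnt R}"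
    using clique_iff by blast
  moreover have "finite {R. R \<subseteq> S \<and> pairwise disjnt R}" "{} \<in> {R. R \<subseteq> S \<and> pairwise disjnt R}"
    using assms by auto
  ultimately show ?thesis
    unfolding clique_number_def by (subst Max_le_iff) auto
qed

lemma independence_number_le_iff:
  assumes "finite S"
  shows "independence_number S (disjointness_edges S) \<le> m \<longleftrightarrow>
    (\<forall>X\<subseteq>S. meeting X \<longrightarrow> card X \<le> m)"
proof -
  have "{R. R \<subseteq> S \<and> indep R (disjointness_edges S)} = {R. R \<subseteq> S \<and> meeting R}"
    using indep_iff by blast
  moreover have "finite {R. R \<subseteq> S \<and> meeting R}" "{} \<in> {R. R \<subseteq> S \<and> meeting R}"
    using assms by auto
  ultimately show ?thesis
    unfolding independence_number_def by (subst Max_le_iff) auto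
qed

section \<open>Segments and affine subspaces\<close>

lemma is_segment_nonempty: "is_segment s \<Longrightarrow> s \<noteq> {}"
  unfolding is_segment_def by auto

lemma not_disjnt_self: "is_segment s \<Longrightarrow> \<not> disjnt s s"
  using is_segment_nonempty by (auto simp: disjnt_def)

text \<open>Two distinct common points would span the line of \<open>u\<close>, and an affine set
  contains the line through any two of its points.\<close>

lemma segment_affine_unique:
  fixes T :: "'a::euclidean_space set"
  assumes "is_segment u" "affine T" "\<not> u \<subseteq> T" "x \<in> u" "x \<in> T" "y \<in> u" "y \<in> T"
  shows "x = y"
proof (rule ccontr)
  assume "x \<noteq> y"
  obtain a b where u: "u = closed_segment a b"
    using assms(1) is_segment_def by blast
  have "z \<in> T" if "z \<in> u" for z
  proof -
    have "collinear {x, y, z}"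
      using collinear_closed_segment[of a b] that assms u by (metis collinear_subset empty_subsetI insert_subset)
    then have "z \<in> affine hull {x, y}"
      using \<open>x \<noteq> y\<close> collinear_3_affine_hull by blast
    also have "\<dots> \<subseteq> T"
      using assms by (intro hull_minimal) auto
    finally show ?thesis .
  qed
  then show False
    using assms(3) by blast
qed

text \<open>All counted segments pass through the only point that \<open>u\<close> has in
  \<open>T\<close>. They therefore form an independent set together with \<open>u\<close>, which is
  not counted itself; hence \<open>m - 1\<close>.\<close>

lemma card_meeting_outside_plane:
  fixes T :: "'a::euclidean_space set"
  assumes "finite R" "u \<in> R" "is_segment u" "affine T" "\<not> u \<subseteq> T"
    and alpha: "\<And>X. X \<subseteq> R \<Longrightarrow> meeting X \<Longrightarrow> card X \<le> m"
  shows "card {t \<in> R. t \<subseteq> T \<and> \<not> disjnt t u} \<le> m - 1"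
proof -
  let ?X = "{t \<in> R. t \<subseteq> T \<and> \<not> disjnt t u}"
  have "\<not> disjnt s t" if "s \<in> ?X" "t \<in> ?X" for s t
  proof -
    obtain x y where "x \<in> s" "x \<in> u" "y \<in> t" "y \<in> u"
      using \<open>s \<in> ?X\<close> \<open>t \<in> ?X\<close> unfolding disjnt_iff by auto
    moreover from this have "x = y"
      using that segment_affine_unique[OF assms(3,4,5)] by blast
    ultimately show ?thesis
      unfolding disjnt_iff by auto
  qed
  then have "meeting (insert u ?X)"
    unfolding pairwise_def using disjnt_sym by blast
  then have "card (insert u ?X) \<le> m"
    using assms by (intro alpha) auto
  moreover have "u \<notin> ?X"
    using assms by auto
  ultimately show ?thesis
    using \<open>finite R\<close> by simp
qed

section \<open>Moving coplanar segments into the plane, away from given ones\<close>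

lemma is_segment_affine_image:
  fixes L :: "'a::euclidean_space \<Rightarrow> 'b::euclidean_space"
  assumes "linear L" "is_segment t" "inj_on (\<lambda>x. v + L x) t"
  shows "is_segment ((\<lambda>x. v + L x) ` t)"
proof -
  obtain a b where ab: "a \<noteq> b" "t = closed_segment a b"
    using assms(2) is_segment_def by blast
  have "(\<lambda>x. v + L x) ` t = closed_segment (v + L a) (v + L b)"
    unfolding ab(2) closed_segment_translation closed_segment_linear_image[OF assms(1)] image_image ..
  moreover have "v + L a \<noteq> v + L b"
    using inj_onD[OF assms(3), of a b] ab by auto
  ultimately show ?thesis
    unfolding is_segment_def by blast
qed

text \<open>The direction space of \<open>p\<close> has dimension at most 2 and embeds isometrically
  into the plane; a long translation then moves the bounded image of \<open>D\<close> off
  \<open>B\<close>.\<close>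

lemma plane_chart_avoiding:
  fixes p :: "'a::euclidean_space set" and B :: "(real ^ 2) set"
  assumes "affine p" "aff_dim p \<le> 2" "bounded D" "bounded B"
  obtains L v where "linear L" "inj_on (\<lambda>x. v + L x) p" "disjnt ((\<lambda>x. v + L x) ` D) B"
proof -
  obtain L :: "'a \<Rightarrow> real ^ 2" where L: "linear L" "inj_on L p"
  proof (cases "p = {}")
    \<comment> \<open>There is no base point here, but every map is injective on the empty
      set.\<close>
    case True
    show ?thesis
      by (rule that[of "\<lambda>_. 0"]) (auto simp: True linear_iff)
  next
    case False
    then obtain c where c: "c \<in> p"
      by blast
    let ?V = "{x - c |x. x \<in> p}"
    have sub: "subspace ?V"
      using affine_diffs_subspace_subtract[OF assms(1) c] by (simp add: setcompr_eq_image)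
    have "aff_dim p = int (dim ?V)"
      using aff_dim_eq_dim_subtract[of c p] c by (simp add: hull_inc setcompr_eq_image)
    then have "dim ?V \<le> 2"
      using assms(2) by linarith
    also have "2 = dim (UNIV :: (real ^ 2) set)"
      by simp
    finally have d: "dim ?V \<le> dim (UNIV :: (real ^ 2) set)" .
    obtain L :: "'a \<Rightarrow> real ^ 2" where L: "linear L" "\<And>x. x \<in> ?V \<Longrightarrow> norm (L x) = norm x"
      by (rule isometry_subset_subspace[OF sub subspace_UNIV d]) (rule that)
    have "inj_on L p"
    proof (rule inj_onI)
      fix x y assume xy: "x \<in> p" "y \<in> p" "L x = L y"
      \<comment> \<open>\<open>L\<close> preserves norms only on the direction space, so
        \<open>x - y\<close> is first written as a difference of two of its elements.\<close>
      have "(x - c) - (y - c) \<in> ?V"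
        by (rule subspace_diff[OF sub]) (use xy in blast)+
      then have "norm (x - y) = norm (L (x - y))"
        using L(2) by simp
      also have "\<dots> = 0"
        using xy(3) L(1) by (simp add: linear_diff)
      finally show "x = y"
        by simp
    qed
    with L(1) show ?thesis
      by (rule that)
  qed
  have "bounded (L ` D)"
    using assms(3) L(1) by (simp add: bounded_linear_image linear_conv_bounded_linear)
  then obtain d b where d: "\<And>x. x \<in> D \<Longrightarrow> norm (L x) \<le> d" and b: "\<And>x. x \<in> B \<Longrightarrow> norm x \<le> b"
    using \<open>bounded B\<close> unfolding bounded_iff by blast
  \<comment> \<open>This length exceeds \<open>d + b\<close>. The absolute values cover negative
    bounds, possible when \<open>D\<close> or \<open>B\<close> is empty.\<close>
  obtain v :: "real ^ 2" where v: "norm v = \<bar>d\<bar> + \<bar>b\<bar> + 1"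
    using vector_choose_size[of "\<bar>d\<bar> + \<bar>b\<bar> + 1"] by auto
  have "v + L x \<notin> B" if "x \<in> D" for x
  proof
    assume "v + L x \<in> B"
    then have "norm (v + L x) \<le> b"
      by (rule b)
    moreover have "norm v \<le> norm (v + L x) + norm (L x)"
      using norm_triangle_ineq4[of "v + L x" "L x"] by simp
    ultimately show False
      using d[OF that] v by linarith
  qed
  then have "disjnt ((\<lambda>x. v + L x) ` D) B"
    unfolding disjnt_iff by auto
  moreover have "inj_on (\<lambda>x. v + L x) p"
    using L(2) unfolding inj_on_def by auto
  ultimately show ?thesis
    using that L(1) by blast
qed

lemma bounded_Union_segments:
  fixes E :: "'a::euclidean_space set set"
  assumes "segment_system E"
  shows "bounded (\<Union>E)"
proof (rule bounded_Union)
  show "finite E"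
    using assms segment_system_def by blast
  show "\<forall>t\<in>E. bounded t"
    using assms bounded_closed_segment unfolding segment_system_def is_segment_def by metis
qed

text \<open>Injectivity of the chart on \<open>p\<close> preserves both meeting and disjointness, so
  the copy has the same disjointness graph. Avoiding \<open>Z\<close> joins every copied segment to
  every old one in that graph.\<close>

lemma planar_copy_avoiding:
  fixes E :: "'a::euclidean_space set set" and Z :: "(real ^ 2) set set"
  assumes E: "segment_system E" "\<And>t. t \<in> E \<Longrightarrow> t \<subseteq> p" and p: "affine p" "aff_dim p \<le> 2"
    and Z: "segment_system Z"
  obtains h :: "'a set \<Rightarrow> (real ^ 2) set" where
    "segment_system (h ` E)" "inj_on h E"
    "\<And>s t. s \<in> E \<Longrightarrow> t \<in> E \<Longrightarrow> disjnt (h s) (h t) \<longleftrightarrow> disjnt s t"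
    "\<And>t z. t \<in> E \<Longrightarrow> z \<in> Z \<Longrightarrow> disjnt (h t) z"
proof -
  obtain L v where L: "linear L" "inj_on (\<lambda>x. v + L x) p" "disjnt ((\<lambda>x. v + L x) ` \<Union>E) (\<Union>Z)"
    using plane_chart_avoiding[OF p bounded_Union_segments[OF E(1)] bounded_Union_segments[OF Z]]
    by blast
  let ?h = "\<lambda>t. (\<lambda>x. v + L x) ` t"
  show ?thesis
  proof (rule that[of ?h])
    have "is_segment (?h t)" if "t \<in> E" for t
      using that E L inj_on_subset is_segment_affine_image unfolding segment_system_def by metis
    then show "segment_system (?h ` E)"
      using E(1) unfolding segment_system_def by auto
    show "inj_on ?h E"
      using E(2) inj_on_image_eq_iff[OF L(2)] unfolding inj_on_def by simp
    show "disjnt (?h s) (?h t) \<longleftrightarrow> disjnt s t" if "s \<in> E" "t \<in> E" for s t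
      using inj_on_image_Int[OF L(2), of s t] E(2) that unfolding disjnt_def
      by (metis image_is_empty)
    show "disjnt (?h t) z" if "t \<in> E" "z \<in> Z" for t z
      using L(3) that unfolding disjnt_iff by blast
  qed
qed

section \<open>Segments covered by finitely many planes\<close>

lemma disjnt_families_disjoint:
  assumes "\<And>s. s \<in> A \<Longrightarrow> is_segment s" "\<And>s t. s \<in> A \<Longrightarrow> t \<in> B \<Longrightarrow> disjnt s t"
  shows "A \<inter> B = {}"
  using assms not_disjnt_self by blast

lemma ex_largest_subset:
  assumes "finite S" "Q {}"
  obtains C where "C \<subseteq> S" "Q C" "\<And>C'. C' \<subseteq> S \<Longrightarrow> Q C' \<Longrightarrow> card C' \<le> card C"
proof -
  let ?F = "{C. C \<subseteq> S \<and> Q C}"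
  have fin: "finite (card ` ?F)"
    using assms(1) by simp
  moreover have "card ` ?F \<noteq> {}"
    using assms(2) by blast
  ultimately obtain C where "C \<in> ?F" "card C = Max (card ` ?F)"
    using Max_in by (metis (no_types, lifting) imageE)
  then show ?thesis
    using that[of C] Max_ge[OF fin] by simp
qed

text \<open>\<open>K\<close> collects the chosen cliques and \<open>Z\<close> the planar copies of
  the kept segments. Bounding the cliques of \<open>Z\<close> by \<open>card K\<close> instead of
  \<open>m\<close> is what survives the induction, since both sides grow by the same amount. Each
  member of \<open>K\<close> costs at most \<open>m - 1\<close> segments in each of at most
  \<open>card P - 1\<close> later planes.\<close>

lemma segments_in_planes_bound:
  fixes P :: "'a::euclidean_space set set" and R :: "'a set set"
  assumes "finite P" "\<And>p. p \<in> P \<Longrightarrow> affine p \<and> aff_dim p \<le> 2"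
    and "segment_system R" "\<And>t. t \<in> R \<Longrightarrow> \<exists>p\<in>P. t \<subseteq> p"
    and "\<And>X. X \<subseteq> R \<Longrightarrow> meeting X \<Longrightarrow> card X \<le> m"
  shows "\<exists>K (Z :: (real ^ 2) set set). K \<subseteq> R \<and> pairwise disjnt K \<and> segment_system Z \<and>
    (\<forall>X\<subseteq>Z. meeting X \<longrightarrow> card X \<le> m) \<and>
    (\<forall>X\<subseteq>Z. pairwise disjnt X \<longrightarrow> card X \<le> card K) \<and>
    card R \<le> card Z + card K * (card P - 1) * (m - 1)"
  using assms
proof (induction P arbitrary: R rule: finite_induct)
  case empty
  then have "R = {}"
    by blast
  then show ?case
    by (intro exI[of _ "{}"]) (auto simp: segment_system_def)
next
  case (insert p P)
  note seg = insert.prems(2) and alpha = insert.prems(4)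
  have p: "affine p" "aff_dim p \<le> 2"
    using insert.prems(1) by auto
  have finR: "finite R" and segR: "\<And>t. t \<in> R \<Longrightarrow> is_segment t"
    using seg unfolding segment_system_def by auto
  \<comment> \<open>Segments in \<open>p\<close> are reserved for \<open>p\<close> even if a plane
    of \<open>P\<close> contains them too. Thus no member of the clique \<open>K\<close> obtained
    from \<open>P\<close> lies in \<open>p\<close>, and each meets \<open>p\<close> in at most one
    point.\<close>
  let ?Rp = "{t \<in> R. t \<subseteq> p}"
  have "\<exists>K (Z :: (real ^ 2) set set). K \<subseteq> R - ?Rp \<and> pairwise disjnt K \<and> segment_system Z \<and>
    (\<forall>X\<subseteq>Z. meeting X \<longrightarrow> card X \<le> m) \<and>
    (\<forall>X\<subseteq>Z. pairwise disjnt X \<longrightarrow> card X \<le> card K) \<and>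
    card (R - ?Rp) \<le> card Z + card K * (card P - 1) * (m - 1)"
  proof (rule insert.IH)
    show "segment_system (R - ?Rp)"
      using seg unfolding segment_system_def by auto
    show "\<exists>q\<in>P. t \<subseteq> q" if "t \<in> R - ?Rp" for t
      using insert.prems(3)[of t] that by auto
    show "affine q \<and> aff_dim q \<le> 2" if "q \<in> P" for q
      using insert.prems(1) that by simp
    show "card X \<le> m" if "X \<subseteq> R - ?Rp" "meeting X" for X
      using alpha[of X] that by blast
  qed
  then obtain K and Z :: "(real ^ 2) set set" where
    K: "K \<subseteq> R - ?Rp" "pairwise disjnt K" and Z: "segment_system Z"
    and Zalpha: "\<And>X. X \<subseteq> Z \<Longrightarrow> meeting X \<Longrightarrow> card X \<le> m"
    and Zomega: "\<And>X. X \<subseteq> Z \<Longrightarrow> pairwise disjnt X \<Longrightarrow> card X \<le> card K"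
    and cardRest: "card (R - ?Rp) \<le> card Z + card K * (card P - 1) * (m - 1)"
    by (elim exE conjE) blast
  have finK: "finite K"
    using K(1) finR finite_subset by blast
  \<comment> \<open>Discarding whatever meets \<open>K\<close> ensures that any clique of
    \<open>E\<close> extends \<open>K\<close> to a larger clique.\<close>
  define E where "E = {t \<in> ?Rp. \<forall>u\<in>K. disjnt t u}"
  have segE: "segment_system E" and finE: "finite E"
    using seg unfolding E_def segment_system_def by simp_all
  obtain Q where Q: "Q \<subseteq> E" "pairwise disjnt Q"
    and Qmax: "\<And>Q'. Q' \<subseteq> E \<Longrightarrow> pairwise disjnt Q' \<Longrightarrow> card Q' \<le> card Q"
    using ex_largest_subset[OF finE, of "pairwise disjnt"] pairwise_empty by metis
  have KQ: "disjnt u t" if "u \<in> K" "t \<in> Q" for u t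
  proof -
    have "t \<in> E"
      using that Q(1) by blast
    then have "disjnt t u"
      using that(1) unfolding E_def by simp
    then show ?thesis
      by (rule disjnt_sym)
  qed
  have KQ_pairwise: "pairwise disjnt (K \<union> Q)"
    using K(2) Q(2) KQ unfolding pairwise_def by (metis Un_iff disjnt_sym)
  have "K \<inter> Q = {}"
    using K(1) Q(1) unfolding E_def by auto
  then have cardKQ: "card (K \<union> Q) = card K + card Q"
    using finK Q(1) finE by (meson card_Un_disjoint finite_subset)
  obtain h where h: "segment_system (h ` E)" "inj_on h E"
    and hdis: "\<And>s t. s \<in> E \<Longrightarrow> t \<in> E \<Longrightarrow> disjnt (h s) (h t) \<longleftrightarrow> disjnt s t"
    and hZ: "\<And>t z. t \<in> E \<Longrightarrow> z \<in> Z \<Longrightarrow> disjnt (h t) z"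
    by (rule planar_copy_avoiding[OF segE _ p Z]) (auto simp: E_def)
  have finZ: "finite Z"
    using Z segment_system_def by blast
  have pull: "\<exists>Y\<subseteq>E. card Y = card X \<and> X = h ` Y" if "X \<subseteq> h ` E" for X
    using that h(2) by (metis card_image inj_on_subset subset_imageE)
  have "h ` E \<inter> Z = {}"
    by (rule disjnt_families_disjoint) (use h(1) hZ in \<open>auto simp: segment_system_def\<close>)
  then have cardZ: "card (Z \<union> h ` E) = card Z + card E"
    using finZ finE h(2) by (simp add: Int_commute card_Un_disjoint card_image)
  \<comment> \<open>Old and new copies are disjoint, so a meeting family lies entirely among one of
    them. Among the new ones it pulls back along \<open>h\<close> to a meeting family in
    \<open>R\<close>.\<close>
  have "card X \<le> m" if X: "X \<subseteq> Z \<union> h ` E" "meeting X" for X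
  proof (cases "X \<subseteq> Z")
    case False
    then obtain t where t: "t \<in> E" "h t \<in> X"
      using X(1) by auto
    have "X \<subseteq> h ` E"
    proof
      fix x assume x: "x \<in> X"
      show "x \<in> h ` E"
      proof (rule ccontr)
        assume "x \<notin> h ` E"
        then have "x \<in> Z" "x \<noteq> h t"
          using x X(1) t by auto
        then show False
          using hZ[OF t(1)] X(2) x t unfolding pairwise_def by metis
      qed
    qed
    then obtain Y where Y: "Y \<subseteq> E" "card Y = card X" "X = h ` Y"
      using pull by blast
    have "meeting Y"
      unfolding pairwise_def
    proof (intro ballI impI)
      fix s t assume st: "s \<in> Y" "t \<in> Y" "s \<noteq> t"
      then have "h s \<noteq> h t"
        using h(2) Y(1) by (metis inj_onD subsetD)
      moreover have "h s \<in> X" "h t \<in> X"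
        using st Y(3) by auto
      ultimately have "\<not> disjnt (h s) (h t)"
        using pairwiseD[OF X(2)] by metis
      then show "\<not> disjnt s t"
        using hdis[of s t] st Y(1) by auto
    qed
    then have "card Y \<le> m"
      using Y(1) by (intro alpha) (auto simp: E_def)
    then show ?thesis
      using Y(2) by simp
  qed (use Zalpha X(2) in blast)
  \<comment> \<open>A clique splits into an old part, at most \<open>card K\<close> by induction,
    and a new part, at most \<open>card Q\<close> by the choice of \<open>Q\<close>.\<close>
  moreover have "card X \<le> card (K \<union> Q)" if X: "X \<subseteq> Z \<union> h ` E" "pairwise disjnt X" for X
  proof -
    have "card (X \<inter> Z) \<le> card K"
      using X(2) by (intro Zomega) (auto intro: pairwise_subset)
    moreover have "card (X \<inter> h ` E) \<le> card Q"
    proof -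
      obtain Y where Y: "Y \<subseteq> E" "card Y = card (X \<inter> h ` E)" "X \<inter> h ` E = h ` Y"
        using pull[of "X \<inter> h ` E"] by auto
      have "pairwise disjnt Y"
        unfolding pairwise_def
      proof (intro ballI impI)
        fix s t assume st: "s \<in> Y" "t \<in> Y" "s \<noteq> t"
        then have "h s \<noteq> h t"
          using h(2) Y(1) by (metis inj_onD subsetD)
        moreover have "h s \<in> X" "h t \<in> X"
          using st Y(3) by auto
        ultimately have "disjnt (h s) (h t)"
          using pairwiseD[OF X(2)] by metis
        then show "disjnt s t"
          using hdis[of s t] st Y(1) by auto
      qed
      then show ?thesis
        using Qmax[OF Y(1)] Y(2) by simp
    qed
    moreover have "card X \<le> card (X \<inter> Z) + card (X \<inter> h ` E)"
      using X(1) card_Un_le[of "X \<inter> Z" "X \<inter> h ` E"] by (simp add: Int_Un_distrib[symmetric] Int_absorb2)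
    ultimately show ?thesis
      using cardKQ by linarith
  qed
  moreover have "card R \<le> card (Z \<union> h ` E) + card (K \<union> Q) * (card (insert p P) - 1) * (m - 1)"
  proof -
    \<comment> \<open>Every discarded segment is charged to a member of \<open>K\<close> that it
      meets.\<close>
    have "?Rp - E \<subseteq> (\<Union>u\<in>K. {t \<in> R. t \<subseteq> p \<and> \<not> disjnt t u})"
      unfolding E_def by auto
    then have "card (?Rp - E) \<le> card (\<Union>u\<in>K. {t \<in> R. t \<subseteq> p \<and> \<not> disjnt t u})"
      using finK finR by (intro card_mono) auto
    also have "\<dots> \<le> (\<Sum>u\<in>K. card {t \<in> R. t \<subseteq> p \<and> \<not> disjnt t u})"
      using finK by (rule card_UN_le)
    also have "\<dots> \<le> (\<Sum>u\<in>K. m - 1)"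
      using K(1) segR by (intro sum_mono card_meeting_outside_plane finR p alpha) auto
    finally have removed: "card (?Rp - E) \<le> card K * (m - 1)"
      by simp
    have "R \<inter> ?Rp = ?Rp" "?Rp \<inter> E = E"
      unfolding E_def by auto
    then have "card R = card ?Rp + card (R - ?Rp)" "card ?Rp = card E + card (?Rp - E)"
      using card_Int_Diff[of R ?Rp] card_Int_Diff[of ?Rp E] finR by auto
    then have R: "card R \<le> card (Z \<union> h ` E) + (card K * (card P - 1) * (m - 1) + card K * (m - 1))"
      using cardRest removed cardZ by linarith
    \<comment> \<open>Subtraction truncates when \<open>P\<close> is empty; then all of
      \<open>R\<close> lies in \<open>p\<close>, so \<open>K\<close> is empty and both sides
      vanish.\<close>
    have "card K * (card P - 1) * (m - 1) + card K * (m - 1) = card K * card P * (m - 1)"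
    proof (cases "P = {}")
      case True
      then have "K = {}"
        using K(1) insert.prems(3) by auto
      then show ?thesis
        by simp
    next
      case False
      then obtain k where "card P = Suc k"
        using insert.hyps(1) by (metis card_gt_0_iff gr0_implies_Suc)
      then show ?thesis
        by (simp add: algebra_simps)
    qed
    also have "\<dots> \<le> card (K \<union> Q) * card P * (m - 1)"
      unfolding cardKQ by (intro mult_right_mono) auto
    finally show ?thesis
      using R insert.hyps by simp
  qed
  moreover have "segment_system (Z \<union> h ` E)"
    using Z h(1) unfolding segment_system_def by auto
  moreover have "K \<union> Q \<subseteq> R"
    using K(1) Q(1) unfolding E_def by auto
  ultimately show ?case
    using KQ_pairwise by (intro exI[of _ "K \<union> Q"] exI[of _ "Z \<union> h ` E"]) auto
qed

section \<open>Segments meeting a fixed segment\<close>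

text \<open>If \<open>x\<close> leaves the line of \<open>s\<close> at a point \<open>c\<close>,
  then \<open>c\<close> and the end points of \<open>s\<close> span a set containing
  \<open>x\<close> as well: it holds both \<open>c\<close> and a point of \<open>x\<close> on
  \<open>s\<close>, and these differ.\<close>

lemma aff_dim_meeting_segments:
  fixes s x :: "'a::euclidean_space set"
  assumes "is_segment s" "is_segment x" "\<not> disjnt s x"
  shows "aff_dim (affine hull (s \<union> x)) \<le> 2"
proof -
  obtain a b where s: "s = closed_segment a b"
    using assms(1) is_segment_def by blast
  obtain q where q: "q \<in> s" "q \<in> x"
    using assms(3) disjnt_iff by blast
  show ?thesis
  proof (cases "x \<subseteq> affine hull s")
    case True
    then have "affine hull (s \<union> x) \<subseteq> affine hull s"
      by (simp add: hull_minimal hull_subset)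
    then have "aff_dim (affine hull (s \<union> x)) \<le> aff_dim (affine hull s)"
      by (rule aff_dim_subset)
    also have "\<dots> = aff_dim {a, b}"
      unfolding s segment_convex_hull by simp
    also have "\<dots> \<le> 2"
      by (simp add: aff_dim_2)
    finally show ?thesis .
  next
    case False
    then obtain c where c: "c \<in> x" "c \<notin> affine hull s"
      by blast
    let ?T = "affine hull {a, b, c}"
    have "s \<subseteq> ?T"
      unfolding s segment_convex_hull
      using convex_hull_subset_affine_hull[of "{a, b}"] hull_mono[of "{a, b}" "{a, b, c}" affine] by auto
    moreover have "x \<subseteq> ?T"
    proof (rule ccontr)
      assume "\<not> x \<subseteq> ?T"
      then have "q = c"
        using segment_affine_unique[of x ?T q c] assms(2) q c \<open>s \<subseteq> ?T\<close>
        by (auto simp: hull_inc)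
      then show False
        using c q by (simp add: hull_inc)
    qed
    ultimately have "aff_dim (affine hull (s \<union> x)) \<le> aff_dim ?T"
      by (intro aff_dim_subset hull_minimal) auto
    also have "\<dots> \<le> int (card {a, b, c}) - 1"
      unfolding aff_dim_affine_hull by (intro aff_dim_le_card) auto
    also have "\<dots> \<le> 2"
      using card_insert_le_m1[of 3 "{b, c}" a] card_insert_le_m1[of 2 "{c}" b] by simp
    finally show ?thesis .
  qed
qed

text \<open>A common point lies in \<open>affine hull (s \<union> x)\<close>, which \<open>y\<close>
  meets only in its foot on \<open>s\<close>. So it lies on \<open>s\<close>, where it must also be
  the foot of \<open>x\<close>; but the feet differ.\<close>

lemma disjnt_distinct_feet:
  fixes s x y :: "'a::euclidean_space set"
  assumes "is_segment x" "is_segment y"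
    and "\<not> x \<subseteq> affine hull s" "\<not> y \<subseteq> affine hull (s \<union> x)"
    and "\<not> disjnt x s" "\<not> disjnt y s" "disjnt (x \<inter> s) (y \<inter> s)"
  shows "disjnt x y"
proof (rule ccontr)
  assume "\<not> disjnt x y"
  then obtain z where z: "z \<in> x" "z \<in> y"
    unfolding disjnt_iff by blast
  obtain a b where a: "a \<in> x" "a \<in> s" and b: "b \<in> y" "b \<in> s"
    using assms(5,6) unfolding disjnt_iff by blast
  have "z = b"
    using segment_affine_unique[OF assms(2) _ assms(4)] z b by (simp add: hull_inc)
  moreover from this have "z = a"
    using segment_affine_unique[OF assms(1) _ assms(3)] z b a by (simp add: hull_inc)
  ultimately show False
    using assms(7) a b unfolding disjnt_iff by blast
qed

text \<open>Greedy choice: take a segment \<open>x\<close> off the line of \<open>s\<close>, drop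
  everything in its plane with \<open>s\<close> or sharing its foot, and repeat. By
  \<open>disjnt_distinct_feet\<close> all later choices are disjoint from \<open>x\<close>.\<close>

lemma transversal_selection:
  fixes s :: "'a::euclidean_space set"
  assumes "finite T" "\<And>t. t \<in> T \<Longrightarrow> is_segment t \<and> \<not> disjnt t s"
  shows "\<exists>M\<subseteq>T. pairwise disjnt M \<and> (\<forall>t\<in>T. t \<subseteq> affine hull s \<or>
    (\<exists>x\<in>M. \<not> x \<subseteq> affine hull s \<and> (t \<subseteq> affine hull (s \<union> x) \<or> \<not> disjnt (t \<inter> s) (x \<inter> s))))"
  using assms
proof (induction "card T" arbitrary: T rule: less_induct)
  case less
  show ?case
  proof (cases "\<forall>t\<in>T. t \<subseteq> affine hull s")
    case True
    then show ?thesis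
      by (intro exI[of _ "{}"]) auto
  next
    case False
    then obtain x where x: "x \<in> T" "\<not> x \<subseteq> affine hull s"
      by blast
    \<comment> \<open>What \<open>x\<close> does not account for; \<open>x\<close> itself drops out,
      so the induction descends.\<close>
    define T' where "T' = {t \<in> T. \<not> t \<subseteq> affine hull (s \<union> x) \<and> disjnt (t \<inter> s) (x \<inter> s)}"
    have "x \<subseteq> affine hull (s \<union> x)"
      using hull_subset[of "s \<union> x" affine] by blast
    then have "T' \<subset> T"
      using x unfolding T'_def by auto
    then have smaller: "card T' < card T"
      using less.prems(1) by (rule psubset_card_mono[rotated])
    have finT': "finite T'"
      using less.prems(1) unfolding T'_def by simp
    have segT': "is_segment t \<and> \<not> disjnt t s" if "t \<in> T'" for t
      using less.prems(2)[of t] that unfolding T'_def by simp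
    from less.hyps[OF smaller finT' segT'] obtain M where M: "M \<subseteq> T'" "pairwise disjnt M"
      and Mcov: "\<forall>t\<in>T'. t \<subseteq> affine hull s \<or> (\<exists>x\<in>M. \<not> x \<subseteq> affine hull s \<and>
        (t \<subseteq> affine hull (s \<union> x) \<or> \<not> disjnt (t \<inter> s) (x \<inter> s)))"
      by meson
    have "disjnt x y" if "y \<in> M" for y
    proof -
      have "y \<in> T'"
        using that M(1) by blast
      then have y: "y \<in> T" "\<not> y \<subseteq> affine hull (s \<union> x)" "disjnt (x \<inter> s) (y \<inter> s)"
        unfolding T'_def by (simp_all add: disjnt_def Int_commute)
      show ?thesis
        using disjnt_distinct_feet[OF _ _ x(2) y(2) _ _ y(3)] less.prems(2) x(1) y(1) by simp
    qed
    then have "pairwise disjnt (insert x M)"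
      using M(2) by (simp add: pairwise_insert disjnt_sym)
    moreover have "insert x M \<subseteq> T"
      using x M(1) unfolding T'_def by auto
    moreover have "t \<subseteq> affine hull s \<or> (\<exists>x\<in>insert x M. \<not> x \<subseteq> affine hull s \<and>
        (t \<subseteq> affine hull (s \<union> x) \<or> \<not> disjnt (t \<inter> s) (x \<inter> s)))" if "t \<in> T" for t
    proof (cases "t \<in> T'")
      case True
      then show ?thesis
        using Mcov by (metis insertI2)
    next
      case False
      then show ?thesis
        using that x(2) unfolding T'_def by simp
    qed
    ultimately show ?thesis
      by (intro exI[of _ "insert x M"]) simp
  qed
qed

text \<open>Each selected transversal \<open>x\<close> contributes one plane through
  \<open>s\<close> to \<open>P\<close> and the segments through its foot to \<open>A\<close>. With
  \<open>s\<close> added, the latter are pairwise meeting, so there are at most \<open>m - 1\<close>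
  of them.\<close>

lemma cover_meeting_segment:
  fixes S :: "'a::euclidean_space set set"
  assumes S: "segment_system S" and "s \<in> S" "m > 0"
    and alpha: "\<And>X. X \<subseteq> S \<Longrightarrow> meeting X \<Longrightarrow> card X \<le> m"
    and omega: "\<And>X. X \<subseteq> S \<Longrightarrow> pairwise disjnt X \<Longrightarrow> card X \<le> m"
  shows "\<exists>A P. A \<subseteq> S \<and> card A \<le> m * (m - 1) \<and> finite P \<and> card P \<le> m \<and>
    (\<forall>p\<in>P. affine p \<and> aff_dim p \<le> 2) \<and>
    (\<forall>t\<in>S. \<not> disjnt t s \<longrightarrow> t \<in> A \<or> (\<exists>p\<in>P. t \<subseteq> p))"
proof -
  have fin: "finite S" and seg: "\<And>t. t \<in> S \<Longrightarrow> is_segment t"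
    using S unfolding segment_system_def by auto
  let ?T = "{t \<in> S. \<not> disjnt t s}"
  have finT: "finite ?T" and segT: "\<And>t. t \<in> ?T \<Longrightarrow> is_segment t \<and> \<not> disjnt t s"
    using fin seg by simp_all
  obtain M where M: "M \<subseteq> ?T" "pairwise disjnt M"
    and cov: "\<forall>t\<in>?T. t \<subseteq> affine hull s \<or> (\<exists>x\<in>M. \<not> x \<subseteq> affine hull s \<and>
      (t \<subseteq> affine hull (s \<union> x) \<or> \<not> disjnt (t \<inter> s) (x \<inter> s)))"
    using transversal_selection[OF finT segT] by meson
  have finM: "finite M" and cardM: "card M \<le> m"
    using M(1) finT finite_subset omega[OF _ M(2)] by auto
  \<comment> \<open>Only members of \<open>M\<close> off the line of \<open>s\<close> act as
    witnesses in \<open>cov\<close>, and these are certain to meet \<open>s\<close> in a single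
    point.\<close>
  define N where "N = {x \<in> M. \<not> x \<subseteq> affine hull s}"
  have N: "finite N" "card N \<le> m"
    using finM cardM card_mono[OF finM, of N] unfolding N_def by auto
  have foot: "\<exists>q. x \<inter> s = {q}" if "x \<in> N" for x
  proof -
    have x: "is_segment x" "\<not> x \<subseteq> affine hull s" "\<not> disjnt x s"
      using that M(1) seg unfolding N_def by auto
    then obtain q where "q \<in> x" "q \<in> s"
      unfolding disjnt_iff by blast
    moreover have "y = q" if "y \<in> x" "y \<in> s" for y
      using segment_affine_unique[OF x(1) affine_affine_hull x(2)] that \<open>q \<in> x\<close> \<open>q \<in> s\<close>
      by (meson hull_inc)
    ultimately show ?thesis
      by blast
  qed
  \<comment> \<open>Leaving out \<open>s\<close> gains the \<open>- 1\<close> in the count;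
    \<open>s\<close> is covered anyway, as every member of \<open>P\<close> contains it.\<close>
  define A where "A = (\<Union>x\<in>N. {t \<in> S. t \<noteq> s \<and> \<not> disjnt (t \<inter> s) (x \<inter> s)})"
  \<comment> \<open>Without transversals, every segment meeting \<open>s\<close> lies on its line,
    and that line alone suffices; \<open>m > 0\<close> leaves room for it.\<close>
  define P where "P = (if N = {} then {affine hull s} else (\<lambda>x. affine hull (s \<union> x)) ` N)"
  show ?thesis
  proof (rule exI[of _ A], rule exI[of _ P], intro conjI)
    show "A \<subseteq> S"
      unfolding A_def by auto
    have "card A \<le> (\<Sum>x\<in>N. card {t \<in> S. t \<noteq> s \<and> \<not> disjnt (t \<inter> s) (x \<inter> s)})"
      unfolding A_def using N(1) by (rule card_UN_le)
    also have "\<dots> \<le> (\<Sum>x\<in>N. m - 1)"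
    proof (rule sum_mono)
      fix x assume "x \<in> N"
      then obtain q where q: "x \<inter> s = {q}"
        using foot by blast
      let ?Y = "{t \<in> S. t \<noteq> s \<and> \<not> disjnt (t \<inter> s) (x \<inter> s)}"
      have "q \<in> t" if "t \<in> insert s ?Y" for t
        using that q by auto
      then have "meeting (insert s ?Y)"
        unfolding pairwise_def disjnt_iff by blast
      then have "card (insert s ?Y) \<le> m"
        using \<open>s \<in> S\<close> by (intro alpha) auto
      then show "card ?Y \<le> m - 1"
        using fin by simp
    qed
    also have "\<dots> \<le> m * (m - 1)"
      using N(2) by simp
    finally show "card A \<le> m * (m - 1)" .
    show "finite P"
      unfolding P_def using N(1) by simp
    show "card P \<le> m"
      unfolding P_def using N \<open>m > 0\<close> card_image_le[OF N(1), of "\<lambda>x. affine hull (s \<union> x)"] by auto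
    have plane: "aff_dim (affine hull (s \<union> x)) \<le> 2" if "x \<in> insert s N" for x
    proof (rule aff_dim_meeting_segments)
      have x: "x \<in> S" "x = s \<or> \<not> disjnt x s"
        using that M(1) \<open>s \<in> S\<close> unfolding N_def by auto
      show "is_segment s" "is_segment x"
        using seg x(1) \<open>s \<in> S\<close> by simp_all
      then show "\<not> disjnt s x"
        using x(2) not_disjnt_self by (metis disjnt_sym)
    qed
    have "affine p \<and> aff_dim p \<le> 2" if "p \<in> P" for p
    proof (cases "N = {}")
      case True
      then show ?thesis
        using that plane[of s] unfolding P_def by simp
    next
      case False
      then obtain x where "x \<in> N" "p = affine hull (s \<union> x)"
        using \<open>p \<in> P\<close> unfolding P_def by auto
      then show ?thesis
        using plane[of x] by simp
    qed
    then show "\<forall>p\<in>P. affine p \<and> aff_dim p \<le> 2"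
      by blast
    have "t \<in> A \<or> (\<exists>p\<in>P. t \<subseteq> p)" if t: "t \<in> S" "\<not> disjnt t s" for t
    proof (cases "t \<subseteq> affine hull s")
      case True
      moreover have "\<exists>p\<in>P. affine hull s \<subseteq> p"
        unfolding P_def by (auto intro!: hull_mono)
      ultimately show ?thesis
        by blast
    next
      case False
      then have "t \<noteq> s"
        using hull_subset[of s affine] by blast
      obtain x where "x \<in> N" "t \<subseteq> affine hull (s \<union> x) \<or> \<not> disjnt (t \<inter> s) (x \<inter> s)"
        using bspec[OF cov, of t] t False unfolding N_def by fast
      then show ?thesis
        using \<open>t \<noteq> s\<close> t unfolding A_def P_def by auto
    qed
    then show "\<forall>t\<in>S. \<not> disjnt t s \<longrightarrow> t \<in> A \<or> (\<exists>p\<in>P. t \<subseteq> p)"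
      by blast
  qed
qed

section \<open>Combining the covers over a maximum clique\<close>

text \<open>\<open>Z\<close> obeys the same two bounds as \<open>S\<close> but lies in the plane, so
  any bound for planar systems applies to it with the same \<open>m\<close>.\<close>

lemma card_segments_le:
  fixes S :: "'a::euclidean_space set set"
  assumes S: "segment_system S" and "m > 0"
    and alpha: "\<And>X. X \<subseteq> S \<Longrightarrow> meeting X \<Longrightarrow> card X \<le> m"
    and omega: "\<And>X. X \<subseteq> S \<Longrightarrow> pairwise disjnt X \<Longrightarrow> card X \<le> m"
  obtains Z :: "(real ^ 2) set set" where "segment_system Z"
    "\<And>X. X \<subseteq> Z \<Longrightarrow> meeting X \<Longrightarrow> card X \<le> m"
    "\<And>X. X \<subseteq> Z \<Longrightarrow> pairwise disjnt X \<Longrightarrow> card X \<le> m"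
    "card S \<le> card Z + m ^ 4"
proof -
  have fin: "finite S" and seg: "\<And>t. t \<in> S \<Longrightarrow> is_segment t"
    using S unfolding segment_system_def by auto
  obtain C where C: "C \<subseteq> S" "pairwise disjnt C"
    and Cmax: "\<And>C'. C' \<subseteq> S \<Longrightarrow> pairwise disjnt C' \<Longrightarrow> card C' \<le> card C"
    using ex_largest_subset[OF fin, of "pairwise disjnt"] pairwise_empty by metis
  have finC: "finite C"
    using C(1) fin finite_subset by blast
  \<comment> \<open>A segment disjoint from all of \<open>C\<close> would enlarge the maximum
    clique.\<close>
  have hit: "\<exists>s\<in>C. \<not> disjnt t s" if "t \<in> S" for t
  proof (rule ccontr)
    assume *: "\<not> (\<exists>s\<in>C. \<not> disjnt t s)"
    then have "t \<notin> C"
      using not_disjnt_self seg that by blast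
    moreover have "pairwise disjnt (insert t C)"
      using * C(2) by (simp add: pairwise_insert disjnt_sym)
    ultimately show False
      using Cmax[of "insert t C"] C(1) finC that by auto
  qed
  let ?good = "\<lambda>s A P. A \<subseteq> S \<and> card A \<le> m * (m - 1) \<and> finite P \<and> card P \<le> m \<and>
      (\<forall>p\<in>P. affine p \<and> aff_dim p \<le> 2) \<and>
      (\<forall>t\<in>S. \<not> disjnt t s \<longrightarrow> t \<in> A \<or> (\<exists>p\<in>P. t \<subseteq> p))"
  have "\<forall>s\<in>C. \<exists>A P. ?good s A P"
  proof
    fix s assume "s \<in> C"
    then have "s \<in> S"
      using C(1) by blast
    then show "\<exists>A P. ?good s A P"
      by (rule cover_meeting_segment[OF S _ \<open>m > 0\<close> alpha omega])
  qed
  from bchoice[OF this] obtain A where "\<forall>s\<in>C. \<exists>P. ?good s (A s) P" ..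
  from bchoice[OF this] obtain P where good: "\<forall>s\<in>C. ?good s (A s) (P s)" ..
  have A: "A s \<subseteq> S" "card (A s) \<le> m * (m - 1)"
    and P: "finite (P s)" "card (P s) \<le> m" "\<forall>p\<in>P s. affine p \<and> aff_dim p \<le> 2"
    and cov: "\<forall>t\<in>S. \<not> disjnt t s \<longrightarrow> t \<in> A s \<or> (\<exists>p\<in>P s. t \<subseteq> p)" if "s \<in> C" for s
    using bspec[OF good that] by simp_all
  have cardC: "card C \<le> m"
    using omega C by blast
  let ?A = "\<Union>s\<in>C. A s" and ?P = "\<Union>s\<in>C. P s"
  have "card ?A \<le> (\<Sum>s\<in>C. card (A s))"
    using finC by (rule card_UN_le)
  also have "\<dots> \<le> card C * (m * (m - 1))"
    using sum_bounded_above[of C "\<lambda>s. card (A s)" "m * (m - 1)"] A(2) by simp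
  also have "\<dots> \<le> m * (m * (m - 1))"
    using cardC by (rule mult_right_mono) simp
  finally have cardA: "card ?A \<le> m * (m * (m - 1))" .
  have "card ?P \<le> (\<Sum>s\<in>C. card (P s))"
    using finC by (rule card_UN_le)
  also have "\<dots> \<le> card C * m"
    using sum_bounded_above[of C "\<lambda>s. card (P s)" m] P(2) by simp
  also have "\<dots> \<le> m * m"
    using cardC by (rule mult_right_mono) simp
  finally have cardP: "card ?P \<le> m * m" .
  have "\<exists>K (Z :: (real ^ 2) set set). K \<subseteq> S - ?A \<and> pairwise disjnt K \<and> segment_system Z \<and>
    (\<forall>X\<subseteq>Z. meeting X \<longrightarrow> card X \<le> m) \<and>
    (\<forall>X\<subseteq>Z. pairwise disjnt X \<longrightarrow> card X \<le> card K) \<and>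
    card (S - ?A) \<le> card Z + card K * (card ?P - 1) * (m - 1)"
  proof (rule segments_in_planes_bound)
    show "finite ?P"
      using finC P(1) by auto
    show "segment_system (S - ?A)"
      using S unfolding segment_system_def by auto
    show "\<exists>p\<in>?P. t \<subseteq> p" if "t \<in> S - ?A" for t
    proof -
      obtain s where "s \<in> C" "\<not> disjnt t s"
        using hit[of t] \<open>t \<in> S - ?A\<close> by blast
      then show ?thesis
        using cov[of s] \<open>t \<in> S - ?A\<close> by blast
    qed
    show "affine p \<and> aff_dim p \<le> 2" if "p \<in> ?P" for p
      using that P(3) by auto
    show "card X \<le> m" if "X \<subseteq> S - ?A" "meeting X" for X
      using alpha[of X] that by blast
  qed
  then obtain K and Z :: "(real ^ 2) set set" where K: "K \<subseteq> S - ?A" "pairwise disjnt K"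
    and Z: "segment_system Z" "\<And>X. X \<subseteq> Z \<Longrightarrow> meeting X \<Longrightarrow> card X \<le> m"
      "\<And>X. X \<subseteq> Z \<Longrightarrow> pairwise disjnt X \<Longrightarrow> card X \<le> card K"
    and cardS: "card (S - ?A) \<le> card Z + card K * (card ?P - 1) * (m - 1)"
    by (elim exE conjE) blast
  \<comment> \<open>\<open>K\<close> is itself a clique of \<open>S\<close>; this turns the clique
    bound \<open>card K\<close> for \<open>Z\<close> into \<open>m\<close>.\<close>
  have cardK: "card K \<le> m"
    using K by (intro omega) auto
  show ?thesis
  proof (rule that[OF Z(1) Z(2)])
    show "card X \<le> m" if "X \<subseteq> Z" "pairwise disjnt X" for X
      using Z(3)[OF that] cardK by simp
    have "S \<inter> ?A = ?A"
      using A(1) by blast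
    then have "card S = card ?A + card (S - ?A)"
      using card_Int_Diff[OF fin, of ?A] by simp
    moreover have "card K * (card ?P - 1) * (m - 1) \<le> m * (m * m - 1) * (m - 1)"
      using cardK cardP by (intro mult_le_mono diff_le_mono) simp_all
    \<comment> \<open>The left side equals \<open>m^4 - 2 * m^2 + m\<close>; writing
      \<open>m\<close> as a successor removes the truncated subtractions.\<close>
    moreover have "m * (m * m - 1) * (m - 1) + m * (m * (m - 1)) \<le> m ^ 4"
    proof -
      obtain k where "m = Suc k"
        using \<open>m > 0\<close> gr0_implies_Suc by blast
      then show ?thesis
        by (simp add: algebra_simps power4_eq_xxxx)
    qed
    ultimately show "card S \<le> card Z + m ^ 4"
      using cardS cardA by linarith
  qed
qed

theorem theorem4p1:
  fixes f :: "nat \<Rightarrow> real"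
  assumes "\<And>(m::nat) (S :: (real ^ 2) set set).
    \<lbrakk>m > 0; segment_system S;
     max (independence_number S (disjointness_edges S)) (clique_number S (disjointness_edges S)) \<le> m\<rbrakk>
    \<Longrightarrow> real (card S) \<le> f m"
  shows "\<forall>(m::nat) (S :: (real ^ 3) set set).
    m > 0 \<longrightarrow> segment_system S \<longrightarrow>
    max (independence_number S (disjointness_edges S)) (clique_number S (disjointness_edges S)) \<le> m
    \<longrightarrow> real (card S) \<le> f m + real m ^ 4"
proof (intro allI impI)
  fix m :: nat and S :: "(real ^ 3) set set"
  assume m: "m > 0" and S: "segment_system S"
    and max: "max (independence_number S (disjointness_edges S)) (clique_number S (disjointness_edges S)) \<le> m"
  have fin: "finite S"
    using S segment_system_def by blast
  obtain Z :: "(real ^ 2) set set" where Z: "segment_system Z"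
    "\<And>X. X \<subseteq> Z \<Longrightarrow> meeting X \<Longrightarrow> card X \<le> m"
    "\<And>X. X \<subseteq> Z \<Longrightarrow> pairwise disjnt X \<Longrightarrow> card X \<le> m"
    "card S \<le> card Z + m ^ 4"
    by (rule card_segments_le[OF S m])
      (use max clique_number_le_iff[OF fin] independence_number_le_iff[OF fin] in auto)
  have "finite Z"
    using Z(1) segment_system_def by blast
  \<comment> \<open>The bounds on subfamilies of \<open>Z\<close> are turned back into bounds on its
    independence and clique numbers, as the hypothesis on \<open>f\<close> requires.\<close>
  then have "real (card Z) \<le> f m"
    using assms[OF m Z(1)] Z(2,3) by (simp add: clique_number_le_iff independence_number_le_iff)
  moreover have "real (card S) \<le> real (card Z) + real m ^ 4"
    using Z(4) by (metis of_nat_add of_nat_le_iff of_nat_power)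
  ultimately show "real (card S) \<le> f m + real m ^ 4"
    by linarith
qed

end
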